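(* Let $(\mathcal{F}(\Omega),\tau)$ be a complete bornological DF-space of $\mathbb{K}$-valued functions on a non-empty set $\Omega$ for which there is a locally convex Hausdorff topology $\widetilde{\tau}$ on $\mathcal{F}(\Omega)$ with $\tau_{\mathrm{p}}\leq\widetilde{\tau}$ such that $(\mathcal{F}(\Omega),\tau)$ satisfies both (BBC) and (CNC) for $\widetilde{\tau}$, i.e. every $\tau$-bounded subset of $\mathcal{F}(\Omega)$ is contained in an absolutely convex $\tau$-bounded $\widetilde{\tau}$-compact set, and $\tau$ has a $0$-neighbourhood basis of absolutely convex $\widetilde{\tau}$-closed sets. Let $U\subset\Omega$ be a set of uniqueness for $\mathcal{F}(\Omega)$, $E$ a complete locally convex Hausdorff space over $\mathbb{K}$, and let the linear subspace $G\subset E'$ determine boundedness of $E$. If $f\colon U\to E$ is a function such that $e'\circ f$ admits an extension $f_{e'}\in\mathcal{F}(\Omega)$ for each $e'\in G$, then there exists a unique extension $F\in\mathcal{F}(\Omega,E)_{\sigma}$ of $f$.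
   Context: $\mathbb{K}=\mathbb{R}$ or $\mathbb{C}$. A locally convex Hausdorff space (or DF-space) of $\mathbb{K}$-valued functions on $\Omega$ is a linear subspace of $\mathbb{K}^{\Omega}$ equipped with some locally convex Hausdorff (DF-) topology. $\tau_{\mathrm{p}}$ is the topology of pointwise convergence on $\Omega$, and $\tau_{0}\leq\tau_{1}$ means that $\tau_{0}$ is coarser than $\tau_{1}$. A set $U\subset\Omega$ is a set of uniqueness for $\mathcal{F}(\Omega)$ if each $f\in\mathcal{F}(\Omega)$ with $f(x)=0$ for all $x\in U$ satisfies $f=0$ on $\Omega$. A linear subspace $G\subset E'$ determines boundedness of $E$ if every $\sigma(E,G)$-bounded set $B\subset E$ is bounded in $E$ (where $B$ is $\sigma(E,G)$-bounded if $\sup_{x\in B}|e'(x)|<\infty$ for every $e'\in G$). $\mathcal{F}(\Omega,E)_{\sigma}:=\{f\colon\Omega\to E\;|\;\forall e'\in E':\ e'\circ f\in\mathcal{F}(\Omega)\}$. *)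

theory Defs
  imports "HOL-Analysis.Analysis" "HOL-Library.Function_Algebras"
begin

text \<open>
  The scalar field: a real normed field that is isometrically isomorphic to the reals or to the
  complex numbers, so that both cases are covered by one type variable.
\<close>

class real_or_complex = real_normed_field +
  assumes real_or_complex:
    "\<exists>\<phi> :: 'a \<Rightarrow> complex.
       (\<forall>x y. \<phi> (x + y) = \<phi> x + \<phi> y) \<and> (\<forall>x y. \<phi> (x * y) = \<phi> x * \<phi> y) \<and> \<phi> 1 = 1 \<and>
       (\<forall>x. norm (\<phi> x) = norm x) \<and> (range \<phi> = \<real> \<or> range \<phi> = UNIV)"

instance real :: real_or_complex
  by standard (rule exI[of _ complex_of_real], auto simp: Reals_def)

instance complex :: real_or_complex
  by standard (rule exI[of _ "\<lambda>z. z"], auto)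

text \<open>
  A topological vector space is given by a scalar multiplication on an ambient group and a
  topology whose carrier \<open>topspace T\<close> is a linear subspace of the ambient vector space.
\<close>

definition topological_vector_space ::
  "('k::real_or_complex \<Rightarrow> 'a::ab_group_add \<Rightarrow> 'a) \<Rightarrow> 'a topology \<Rightarrow> bool" where
  "topological_vector_space smul T \<longleftrightarrow>
     vector_space smul \<and> module.subspace smul (topspace T) \<and>
     continuous_map (prod_topology T T) T (\<lambda>(x, y). x + y) \<and>
     continuous_map (prod_topology euclidean T) T (\<lambda>(c, x). smul c x)"

definition zero_neighbourhood :: "'a::zero topology \<Rightarrow> 'a set \<Rightarrow> bool" where
  "zero_neighbourhood T W \<longleftrightarrow> W \<subseteq> topspace T \<and> (\<exists>S. openin T S \<and> 0 \<in> S \<and> S \<subseteq> W)"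

definition absolutely_convex ::
  "('k::real_or_complex \<Rightarrow> 'a::ab_group_add \<Rightarrow> 'a) \<Rightarrow> 'a set \<Rightarrow> bool" where
  "absolutely_convex smul A \<longleftrightarrow>
     (\<forall>x\<in>A. \<forall>y\<in>A. \<forall>a b. norm a + norm b \<le> 1 \<longrightarrow> smul a x + smul b y \<in> A)"

definition locally_convex_hausdorff ::
  "('k::real_or_complex \<Rightarrow> 'a::ab_group_add \<Rightarrow> 'a) \<Rightarrow> 'a topology \<Rightarrow> bool" where
  "locally_convex_hausdorff smul T \<longleftrightarrow>
     topological_vector_space smul T \<and> Hausdorff_space T \<and>
     (\<forall>W. zero_neighbourhood T W \<longrightarrow>
        (\<exists>C. zero_neighbourhood T C \<and> absolutely_convex smul C \<and> C \<subseteq> W))"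

definition absorbs ::
  "('k::real_or_complex \<Rightarrow> 'a::ab_group_add \<Rightarrow> 'a) \<Rightarrow> 'a set \<Rightarrow> 'a set \<Rightarrow> bool" where
  "absorbs smul W B \<longleftrightarrow> (\<exists>r>0. \<forall>c. r \<le> norm c \<longrightarrow> B \<subseteq> smul c ` W)"

definition tvs_bounded ::
  "('k::real_or_complex \<Rightarrow> 'a::ab_group_add \<Rightarrow> 'a) \<Rightarrow> 'a topology \<Rightarrow> 'a set \<Rightarrow> bool" where
  "tvs_bounded smul T B \<longleftrightarrow>
     B \<subseteq> topspace T \<and> (\<forall>W. zero_neighbourhood T W \<longrightarrow> absorbs smul W B)"

text \<open>Completeness is in the sense of Cauchy filters on the carrier.\<close>

definition tvs_cauchy_filter :: "'a::ab_group_add topology \<Rightarrow> 'a filter \<Rightarrow> bool" where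
  "tvs_cauchy_filter T \<F> \<longleftrightarrow>
     \<F> \<noteq> bot \<and> \<F> \<le> principal (topspace T) \<and>
     (\<forall>W. zero_neighbourhood T W \<longrightarrow> (\<forall>\<^sub>F (x, y) in \<F> \<times>\<^sub>F \<F>. x - y \<in> W))"

definition tvs_complete :: "'a::ab_group_add topology \<Rightarrow> bool" where
  "tvs_complete T \<longleftrightarrow> (\<forall>\<F>. tvs_cauchy_filter T \<F> \<longrightarrow> (\<exists>l. limitin T (\<lambda>x. x) l \<F>))"

definition bornological ::
  "('k::real_or_complex \<Rightarrow> 'a::ab_group_add \<Rightarrow> 'a) \<Rightarrow> 'a topology \<Rightarrow> bool" where
  "bornological smul T \<longleftrightarrow>
     (\<forall>A. A \<subseteq> topspace T \<and> absolutely_convex smul A \<and>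
        (\<forall>B. tvs_bounded smul T B \<longrightarrow> absorbs smul A B) \<longrightarrow> zero_neighbourhood T A)"

text \<open>
  A functional on the carrier is represented by its extension by zero to the ambient type, so
  that distinct elements of the dual are distinct functions; if the carrier is the whole type,
  this condition is void.
\<close>

definition topological_dual ::
  "('k::real_or_complex \<Rightarrow> 'a::ab_group_add \<Rightarrow> 'a) \<Rightarrow> 'a topology \<Rightarrow> ('a \<Rightarrow> 'k) set" where
  "topological_dual smul T =
     {\<phi>. (\<forall>x\<in>topspace T. \<forall>y\<in>topspace T. \<phi> (x + y) = \<phi> x + \<phi> y) \<and>
         (\<forall>c. \<forall>x\<in>topspace T. \<phi> (smul c x) = c * \<phi> x) \<and>
         continuous_map T euclidean \<phi> \<and> (\<forall>x. x \<notin> topspace T \<longrightarrow> \<phi> x = 0)}"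

definition equicontinuous :: "'a::zero topology \<Rightarrow> ('a \<Rightarrow> 'k::real_or_complex) set \<Rightarrow> bool" where
  "equicontinuous T M \<longleftrightarrow>
     (\<exists>W. zero_neighbourhood T W \<and> (\<forall>\<phi>\<in>M. \<forall>x\<in>W. norm (\<phi> x) \<le> 1))"

text \<open>
  Boundedness for the topology of uniform convergence on bounded sets, that is, in the strong dual.
\<close>

definition strongly_bounded ::
  "('k::real_or_complex \<Rightarrow> 'a::ab_group_add \<Rightarrow> 'a) \<Rightarrow> 'a topology \<Rightarrow> ('a \<Rightarrow> 'k) set \<Rightarrow> bool" where
  "strongly_bounded smul T M \<longleftrightarrow>
     (\<forall>B. tvs_bounded smul T B \<longrightarrow> (\<exists>C. \<forall>\<phi>\<in>M. \<forall>x\<in>B. norm (\<phi> x) \<le> C))"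

text \<open>
  Grothendieck's definition: a fundamental sequence of bounded sets, and every strongly bounded
  countable union of equicontinuous subsets of the dual is equicontinuous.
\<close>

definition DF_space ::
  "('k::real_or_complex \<Rightarrow> 'a::ab_group_add \<Rightarrow> 'a) \<Rightarrow> 'a topology \<Rightarrow> bool" where
  "DF_space smul T \<longleftrightarrow>
     locally_convex_hausdorff smul T \<and>
     (\<exists>B :: nat \<Rightarrow> 'a set. (\<forall>n. tvs_bounded smul T (B n)) \<and>
        (\<forall>A. tvs_bounded smul T A \<longrightarrow> (\<exists>n. A \<subseteq> B n))) \<and>
     (\<forall>M :: nat \<Rightarrow> ('a \<Rightarrow> 'k) set.
        (\<forall>n. M n \<subseteq> topological_dual smul T \<and> equicontinuous T (M n)) \<and>
        strongly_bounded smul T (\<Union>n. M n) \<longrightarrow> equicontinuous T (\<Union>n. M n))"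

definition determines_boundedness ::
  "('k::real_or_complex \<Rightarrow> 'a::ab_group_add \<Rightarrow> 'a) \<Rightarrow> 'a topology \<Rightarrow> ('a \<Rightarrow> 'k) set \<Rightarrow> bool" where
  "determines_boundedness smul T G \<longleftrightarrow>
     (\<forall>B \<subseteq> topspace T. (\<forall>\<phi>\<in>G. \<exists>C. \<forall>x\<in>B. norm (\<phi> x) \<le> C) \<longrightarrow> tvs_bounded smul T B)"

text \<open>
  Spaces of scalar-valued functions: the set \<open>\<Omega>\<close> is the type \<open>'x\<close>, and a topology on a function
  space \<open>\<F>(\<Omega>)\<close> is one with carrier \<open>\<F>(\<Omega>)\<close>.
\<close>

definition fun_smul :: "'k::real_or_complex \<Rightarrow> ('x \<Rightarrow> 'k) \<Rightarrow> 'x \<Rightarrow> 'k" where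
  "fun_smul c f = (\<lambda>x. c * f x)"

lemma vector_space_fun_smul: "vector_space fun_smul"
  by unfold_locales (auto simp: fun_smul_def fun_eq_iff algebra_simps)

definition pointwise_topology :: "('x \<Rightarrow> 'k::real_or_complex) set \<Rightarrow> ('x \<Rightarrow> 'k) topology" where
  "pointwise_topology \<F> = subtopology (product_topology (\<lambda>_. euclidean) UNIV) \<F>"

definition coarser_topology :: "'a topology \<Rightarrow> 'a topology \<Rightarrow> bool" where
  "coarser_topology T0 T1 \<longleftrightarrow> topspace T0 = topspace T1 \<and> (\<forall>S. openin T0 S \<longrightarrow> openin T1 S)"

definition BBC ::
  "('k::real_or_complex \<Rightarrow> 'a::ab_group_add \<Rightarrow> 'a) \<Rightarrow> 'a topology \<Rightarrow> 'a topology \<Rightarrow> bool" where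
  "BBC smul T T' \<longleftrightarrow>
     (\<forall>B. tvs_bounded smul T B \<longrightarrow>
        (\<exists>K. B \<subseteq> K \<and> absolutely_convex smul K \<and> tvs_bounded smul T K \<and> compactin T' K))"

definition CNC ::
  "('k::real_or_complex \<Rightarrow> 'a::ab_group_add \<Rightarrow> 'a) \<Rightarrow> 'a topology \<Rightarrow> 'a topology \<Rightarrow> bool" where
  "CNC smul T T' \<longleftrightarrow>
     (\<forall>W. zero_neighbourhood T W \<longrightarrow>
        (\<exists>C \<subseteq> W. zero_neighbourhood T C \<and> absolutely_convex smul C \<and> closedin T' C))"

definition set_of_uniqueness :: "('x \<Rightarrow> 'k::real_or_complex) set \<Rightarrow> 'x set \<Rightarrow> bool" where
  "set_of_uniqueness \<F> U \<longleftrightarrow> (\<forall>f\<in>\<F>. (\<forall>x\<in>U. f x = 0) \<longrightarrow> (\<forall>x. f x = 0))"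

definition weak_vector_valued ::
  "('x \<Rightarrow> 'k::real_or_complex) set \<Rightarrow> ('k \<Rightarrow> 'e::ab_group_add \<Rightarrow> 'e) \<Rightarrow> 'e topology \<Rightarrow> ('x \<Rightarrow> 'e) set"
  where
  "weak_vector_valued \<F> smul T =
     {f. range f \<subseteq> topspace T \<and> (\<forall>e'\<in>topological_dual smul T. e' \<circ> f \<in> \<F>)}"

end

theory Submission
  imports Defs
begin

(* Extend f linearly to T on the finitely supported measures mu on U and topologise these by uniform
   convergence on the bounded subsets of F. A sequence of absolutely convex, pointwise compact sets
   K n is cofinal among these, so T is continuous as soon as it maps bounded sequences to bounded
   ones, and this is what "G determines boundedness" gives. Separating points from the pointwise
   compact sets K n (a nearest point argument in finitely many coordinates) yields both that every
   point evaluation is a limit of measures on U, so that F x can be defined as a limit in E, and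
   that e' o T is the evaluation at an element of F for each e' in E'. *)

section \<open>The scalar field\<close>

text \<open>The embedding \<open>\<phi>\<close> into the complex numbers pulls back the real part
  and, since its range is the reals or everything, also conjugation. This supplies the inner product
  and the expansion of a squared norm along a line, so that a nearest point argument runs over both
  fields at once.\<close>

lemma scalar_structure:
  obtains re :: "'k::real_or_complex \<Rightarrow> real" and conj :: "'k \<Rightarrow> 'k"
  where "\<And>x y. re (x + y) = re x + re y"
    and "\<And>r x. re (of_real r * x) = r * re x"
    and "\<And>x. re x \<le> norm x"
    and "\<And>x y t. (norm (x - of_real t * y))\<^sup>2 = (norm x)\<^sup>2 - 2 * t * re (conj x * y) + t\<^sup>2 * (norm y)\<^sup>2"
    and "\<And>x. re (conj x * x) = (norm x)\<^sup>2"
    and "\<And>x. norm (conj x) = norm x"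
proof -
  obtain \<phi> :: "'k \<Rightarrow> complex" where add: "\<And>x y. \<phi> (x + y) = \<phi> x + \<phi> y"
    and mult: "\<And>x y. \<phi> (x * y) = \<phi> x * \<phi> y" and one: "\<phi> 1 = 1"
    and nrm: "\<And>x. norm (\<phi> x) = norm x" and rng: "range \<phi> = \<real> \<or> range \<phi> = UNIV"
    using real_or_complex by blast
  \<comment> \<open>Real-linearity is not part of the assumptions on \<open>\<phi>\<close>. But
    \<open>\<phi>\<close> preserves the distances of \<open>of_real r\<close> to 0 and to 1, and
    these two distances force the real part to be \<open>r\<close> and the imaginary part to be
    0.\<close>
  have of_real: "\<phi> (of_real r) = of_real r" for r
  proof -
    have "\<phi> (of_real r - 1) + 1 = \<phi> (of_real r)"
      using add[of "of_real r - 1" 1] one by simp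
    then have "norm (\<phi> (of_real r) - 1) = norm (of_real r - 1 :: 'k)"
      by (metis add_diff_cancel_right' nrm)
    then have "norm (\<phi> (of_real r) - 1) = \<bar>r - 1\<bar>"
      by (metis norm_of_real of_real_1 of_real_diff)
    moreover have "norm (\<phi> (of_real r)) = \<bar>r\<bar>" by (simp add: nrm)
    ultimately have "(norm (\<phi> (of_real r) - 1))\<^sup>2 = (r - 1)\<^sup>2" "(norm (\<phi> (of_real r)))\<^sup>2 = r\<^sup>2"
      by simp_all
    then have *: "(Re (\<phi> (of_real r)) - 1)\<^sup>2 + (Im (\<phi> (of_real r)))\<^sup>2 = (r - 1)\<^sup>2"
      "(Re (\<phi> (of_real r)))\<^sup>2 + (Im (\<phi> (of_real r)))\<^sup>2 = r\<^sup>2"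
      by (simp_all add: cmod_power2)
    then have "Re (\<phi> (of_real r)) = r"
      by (simp add: power2_eq_square algebra_simps)
    with * show ?thesis by (simp add: complex_eq_iff)
  qed
  have "\<exists>c. \<phi> c = cnj (\<phi> x)" for x
    using rng
  proof
    assume "range \<phi> = \<real>"
    then have "\<phi> x \<in> \<real>" by blast
    then have "cnj (\<phi> x) = \<phi> x" by (simp add: Reals_cnj_iff)
    then show ?thesis by metis
  next
    assume "range \<phi> = UNIV"
    then show ?thesis by (metis surjD)
  qed
  then obtain conj where conj: "\<And>x. \<phi> (conj x) = cnj (\<phi> x)" by metis
  have diff: "\<phi> (x - y) = \<phi> x - \<phi> y" for x y
    using add[of "x - y" y] by simp
  show ?thesis
  proof (rule that[of "\<lambda>x. Re (\<phi> x)" conj])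
    show "Re (\<phi> x) \<le> norm x" for x by (metis complex_Re_le_cmod nrm)
    show "(norm (x - of_real t * y))\<^sup>2
        = (norm x)\<^sup>2 - 2 * t * Re (\<phi> (conj x * y)) + t\<^sup>2 * (norm y)\<^sup>2" for x y t
      unfolding nrm[symmetric] cmod_power2
      by (simp add: diff mult of_real conj power2_eq_square algebra_simps)
    show "Re (\<phi> (conj x * x)) = (norm x)\<^sup>2" for x
      unfolding nrm[symmetric] cmod_power2 by (simp add: mult conj power2_eq_square)
    show "norm (conj x) = norm x" for x
      by (metis complex_mod_cnj conj nrm)
  qed (simp_all add: add mult of_real)
qed

section \<open>Finitely supported measures\<close>

text \<open>The integral of \<open>g\<close> against the measure \<open>\<mu>\<close>. With field
  multiplication as \<open>smul\<close> it is the duality pairing of measures and scalar functions;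
  with \<open>smulE\<close> and \<open>f\<close> it is the linear map T into E.\<close>

definition lincomb :: "('k::zero \<Rightarrow> 'v \<Rightarrow> 'v) \<Rightarrow> ('x \<Rightarrow> 'k) \<Rightarrow> ('x \<Rightarrow> 'v) \<Rightarrow> 'v::comm_monoid_add" where
  "lincomb smul \<mu> g = (\<Sum>x | \<mu> x \<noteq> 0. smul (\<mu> x) (g x))"

definition finsupp :: "'x set \<Rightarrow> ('x \<Rightarrow> 'k::zero) set" where
  "finsupp U = {\<mu>. finite {x. \<mu> x \<noteq> 0} \<and> {x. \<mu> x \<noteq> 0} \<subseteq> U}"

lemma finsupp_diff:
  fixes \<mu> \<nu> :: "'x \<Rightarrow> 'k::ab_group_add"
  assumes "\<mu> \<in> finsupp U" "\<nu> \<in> finsupp U"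
  shows "(\<lambda>x. \<mu> x - \<nu> x) \<in> finsupp U"
proof -
  have "{x. \<mu> x - \<nu> x \<noteq> 0} \<subseteq> {x. \<mu> x \<noteq> 0} \<union> {x. \<nu> x \<noteq> 0}" by auto
  with assms show ?thesis
    unfolding finsupp_def by (auto intro: finite_subset)
qed

lemma finsupp_scale:
  fixes \<mu> :: "'x \<Rightarrow> 'k::mult_zero"
  assumes "\<mu> \<in> finsupp U"
  shows "(\<lambda>x. c * \<mu> x) \<in> finsupp U"
proof -
  have "{x. c * \<mu> x \<noteq> 0} \<subseteq> {x. \<mu> x \<noteq> 0}" by auto
  with assms show ?thesis
    unfolding finsupp_def by (auto intro: finite_subset)
qed

context vector_space
begin

lemma lincomb_superset:
  assumes "finite A" "{x. \<mu> x \<noteq> 0} \<subseteq> A"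
  shows "lincomb scale \<mu> g = (\<Sum>x\<in>A. scale (\<mu> x) (g x))"
  unfolding lincomb_def using assms by (intro sum.mono_neutral_left) auto

lemma lincomb_diff:
  assumes "\<mu> \<in> finsupp U" "\<nu> \<in> finsupp U"
  shows "lincomb scale (\<lambda>x. \<mu> x - \<nu> x) g = lincomb scale \<mu> g - lincomb scale \<nu> g"
proof -
  let ?A = "{x. \<mu> x \<noteq> 0} \<union> {x. \<nu> x \<noteq> 0}"
  have "finite ?A" using assms by (simp add: finsupp_def)
  then show ?thesis
    by (subst (1 2 3) lincomb_superset[of ?A])
      (auto simp: scale_left_diff_distrib sum_subtractf)
qed

lemma lincomb_scale:
  assumes "\<mu> \<in> finsupp U"
  shows "lincomb scale (\<lambda>x. c * \<mu> x) g = scale c (lincomb scale \<mu> g)"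
proof -
  have "finite {x. \<mu> x \<noteq> 0}" using assms by (simp add: finsupp_def)
  then show ?thesis
    by (subst (1 2) lincomb_superset[of "{x. \<mu> x \<noteq> 0}"])
      (auto simp: scale_sum_right)
qed

end

lemma vector_space_times: "vector_space ((*) :: 'k::field \<Rightarrow> 'k \<Rightarrow> 'k)"
  by unfold_locales (auto simp: algebra_simps)

lemmas pairing_superset = vector_space.lincomb_superset[OF vector_space_times]
lemmas pairing_diff = vector_space.lincomb_diff[OF vector_space_times]
lemmas pairing_scale = vector_space.lincomb_scale[OF vector_space_times]

lemma pairing_cong:
  assumes "\<mu> \<in> finsupp U" "\<And>x. x \<in> U \<Longrightarrow> g x = h x"
  shows "lincomb (*) \<mu> g = lincomb (*) \<mu> h"
  unfolding lincomb_def using assms by (intro sum.cong) (auto simp: finsupp_def)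

lemma pairing_scale_right:
  fixes \<mu> g :: "'x \<Rightarrow> 'k::field"
  shows "lincomb (*) \<mu> (\<lambda>x. c * g x) = c * lincomb (*) \<mu> g"
  by (simp add: lincomb_def sum_distrib_left mult.left_commute)

section \<open>Separation from pointwise compact sets\<close>

text \<open>Agreement with \<open>z\<close> at one coordinate is a closed condition in the product
  topology, so the finite intersection property of \<open>K\<close> applies. Separation is thereby
  reduced to finitely many coordinates.\<close>

lemma compact_finite_agreement:
  fixes K :: "('x \<Rightarrow> 'k::t1_space) set"
  assumes "compact K" and "\<not> (\<exists>h\<in>K. \<forall>x\<in>S. h x = z x)"
  obtains A where "finite A" "A \<subseteq> S" "\<not> (\<exists>h\<in>K. \<forall>x\<in>A. h x = z x)"
proof -
  have "\<exists>A. finite A \<and> A \<subseteq> S \<and> K \<inter> (\<Inter>x\<in>A. {h. h x = z x}) = {}"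
  proof (rule ccontr)
    assume none: "\<not> ?thesis"
    have closed: "closed {h :: 'x \<Rightarrow> 'k. h x = z x}" for x
    proof -
      have "{h :: 'x \<Rightarrow> 'k. h x = z x} = (\<lambda>h. h x) -` {z x}" by auto
      moreover have "continuous_on UNIV (\<lambda>h :: 'x \<Rightarrow> 'k. h x)"
        by (rule continuous_on_product_coordinates)
      ultimately show ?thesis by (simp add: closed_vimage)
    qed
    have "K \<inter> (\<Inter>x\<in>S. {h. h x = z x}) \<noteq> {}"
    proof (rule compact_imp_fip_image[OF assms(1) closed])
      show "K \<inter> (\<Inter>x\<in>A. {h. h x = z x}) \<noteq> {}" if "finite A" "A \<subseteq> S" for A
        using none that by simp
    qed
    with assms(2) show False by blast
  qed
  then obtain A where "finite A" "A \<subseteq> S" "K \<inter> (\<Inter>x\<in>A. {h. h x = z x}) = {}"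
    by (elim exE conjE)
  then show thesis by (intro that[of A]) auto
qed

text \<open>A Hahn-Banach separation by a finitely supported functional. On a finite set of
  coordinates where no element of \<open>K\<close> coincides with \<open>z\<close>, compactness
  yields a Euclidean nearest point \<open>p\<close> of \<open>K\<close> to \<open>z\<close>, and the
  inner product with \<open>z - p\<close> separates. Absolute convexity turns bounds on real parts
  into bounds on norms.\<close>

lemma separation_compact_absolutely_convex:
  fixes K :: "('x \<Rightarrow> 'k::real_or_complex) set"
  assumes "compact K" "absolutely_convex fun_smul K" "K \<noteq> {}"
    and "\<not> (\<exists>h\<in>K. \<forall>x\<in>S. h x = z x)"
  obtains \<mu> where "\<mu> \<in> finsupp S" "\<And>h. h \<in> K \<Longrightarrow> norm (lincomb (*) \<mu> h) \<le> 1"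
    "norm (lincomb (*) \<mu> z) > 1"
proof -
  obtain re :: "'k \<Rightarrow> real" and conj :: "'k \<Rightarrow> 'k" where
    re_add: "\<And>x y. re (x + y) = re x + re y"
    and re_scale: "\<And>r x. re (of_real r * x) = r * re x"
    and re_le: "\<And>x. re x \<le> norm x"
    and norm_line: "\<And>x y t. (norm (x - of_real t * y))\<^sup>2
      = (norm x)\<^sup>2 - 2 * t * re (conj x * y) + t\<^sup>2 * (norm y)\<^sup>2"
    and re_conj: "\<And>x. re (conj x * x) = (norm x)\<^sup>2"
    and norm_conj: "\<And>x. norm (conj x) = norm x"
    by (rule scalar_structure) blast
  have re_0: "re 0 = 0" using re_scale[of 0 0] by simp
  have re_sum: "re (\<Sum>x\<in>B. g x) = (\<Sum>x\<in>B. re (g x))" for g :: "'x \<Rightarrow> 'k" and B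
    by (induction B rule: infinite_finite_induct) (simp_all add: re_0 re_add)
  obtain A where A: "finite A" "A \<subseteq> S" "\<not> (\<exists>h\<in>K. \<forall>x\<in>A. h x = z x)"
    using compact_finite_agreement assms(1,4) by metis
  have "continuous_on K (\<lambda>h. \<Sum>x\<in>A. (norm (z x - h x))\<^sup>2)"
    by (intro continuous_intros continuous_on_subset[OF continuous_on_product_coordinates]) auto
  then obtain p where p: "p \<in> K"
    "\<And>h. h \<in> K \<Longrightarrow> (\<Sum>x\<in>A. (norm (z x - p x))\<^sup>2) \<le> (\<Sum>x\<in>A. (norm (z x - h x))\<^sup>2)"
    using continuous_attains_inf[OF assms(1,3)] by blast
  \<comment> \<open>\<open>w\<close> is the normal direction at the nearest point, \<open>d\<close>
    the squared distance, and \<open>I\<close> the inner product with \<open>w\<close> over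
    \<open>A\<close>.\<close>
  define w where "w x = z x - p x" for x
  define d where "d = (\<Sum>x\<in>A. (norm (w x))\<^sup>2)"
  define I where "I h = (\<Sum>x\<in>A. conj (w x) * h x)" for h
  have convexK: "fun_smul (of_real (1 - t)) p + fun_smul (of_real t) h \<in> K"
    if "h \<in> K" "0 \<le> t" "t \<le> 1" for h t
    using assms(2) p(1) that unfolding absolutely_convex_def by (simp flip: of_real_diff)
  have I_le: "re (I h) \<le> re (I p)" if h: "h \<in> K" for h
  proof -
    define a where "a = (\<Sum>x\<in>A. re (conj (w x) * (h x - p x)))"
    define b where "b = (\<Sum>x\<in>A. (norm (h x - p x))\<^sup>2)"
    \<comment> \<open>Moving from \<open>p\<close> towards \<open>h\<close> by the fraction
      \<open>t\<close> changes the squared distance by \<open>t\<^sup>2 * b - 2 * t * a\<close>,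
      which is nonnegative because \<open>p\<close> is nearest. Letting \<open>t\<close> tend to 0
      then gives \<open>a \<le> 0\<close>.\<close>
    have "2 * a \<le> t * b" if t: "0 < t" "t \<le> 1" for t
    proof -
      let ?q = "fun_smul (of_real (1 - t)) p + fun_smul (of_real t) h"
      have "d \<le> (\<Sum>x\<in>A. (norm (z x - ?q x))\<^sup>2)"
        unfolding d_def w_def using t h by (intro p(2) convexK) auto
      also have "\<dots> = (\<Sum>x\<in>A. (norm (w x - of_real t * (h x - p x)))\<^sup>2)"
        by (simp add: w_def fun_smul_def algebra_simps)
      also have "\<dots> = d - 2 * t * a + t\<^sup>2 * b"
        by (simp add: norm_line d_def a_def b_def sum.distrib sum_subtractf sum_distrib_left)
      finally have "t * (2 * a) \<le> t * (t * b)" by (simp add: power2_eq_square algebra_simps)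
      with t show ?thesis by simp
    qed
    then have "\<forall>\<^sub>F t in at_right 0. 2 * a \<le> t * b"
      by (auto simp: eventually_at_right_field intro!: exI[of _ 1])
    moreover have "((\<lambda>t. t * b) \<longlongrightarrow> 0 * b) (at_right 0)" by (intro tendsto_intros)
    ultimately have "2 * a \<le> 0 * b" using tendsto_lowerbound trivial_limit_at_right_real by blast
    moreover have "re (I h) = a + re (I p)"
      by (simp add: I_def re_sum a_def algebra_simps flip: sum.distrib re_add)
    ultimately show ?thesis by simp
  qed
  have norm_I_le: "norm (I h) \<le> re (I p)" if h: "h \<in> K" for h
  proof (cases "I h = 0")
    case True
    \<comment> \<open>There is no phase to rotate here, but \<open>0 \<in> K\<close> already shows
      that \<open>re (I p)\<close> is nonnegative.\<close>
    have "fun_smul 0 h + fun_smul 0 h \<in> K"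
      using h assms(2) unfolding absolutely_convex_def by (metis add_0 norm_zero zero_le_one)
    from I_le[OF this] True show ?thesis by (simp add: I_def re_0 fun_smul_def)
  next
    case False
    \<comment> \<open>\<open>c\<close> is the factor of norm 1 that rotates \<open>I h\<close> onto
      \<open>norm (I h)\<close>; multiplication by it stays inside \<open>K\<close>.\<close>
    define c where "c = of_real (inverse (norm (I h))) * conj (I h)"
    have "norm c = 1" using False by (simp add: c_def norm_mult norm_conj norm_inverse)
    then have "norm c + norm (0::'k) \<le> 1" by simp
    then have "fun_smul c h + fun_smul 0 h \<in> K"
      using h assms(2) unfolding absolutely_convex_def by blast
    moreover have "fun_smul c h + fun_smul 0 h = (\<lambda>x. c * h x)" by (auto simp: fun_smul_def)
    ultimately have "re (I (\<lambda>x. c * h x)) \<le> re (I p)" using I_le by simp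
    moreover have "I (\<lambda>x. c * h x) = c * I h"
      by (simp add: I_def sum_distrib_left mult.left_commute)
    moreover have "re (c * I h) = norm (I h)"
      using False unfolding c_def mult.assoc re_scale re_conj by (simp add: power2_eq_square)
    ultimately show ?thesis by simp
  qed
  have "d > 0"
  proof -
    obtain x where "x \<in> A" "w x \<noteq> 0" using A(3) p(1) by (force simp: w_def)
    then show ?thesis unfolding d_def using A(1) by (intro sum_pos2[of _ x]) auto
  qed
  have "re (I z) = re (I p) + d"
    by (simp add: I_def re_sum d_def re_conj[symmetric] w_def right_diff_distrib
        flip: sum.distrib re_add)
  then have "norm (I z) > re (I p) + d / 2" using re_le[of "I z"] \<open>d > 0\<close> by simp
  \<comment> \<open>\<open>M\<close> lies halfway in the gap \<open>d\<close> between
    \<open>re (I p)\<close> and \<open>re (I z)\<close>: it is positive even if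
    \<open>re (I p) = 0\<close>, so it can serve as a divisor, and it is still strictly below
    \<open>norm (I z)\<close>.\<close>
  define M where "M = re (I p) + d / 2"
  have "M > 0" using norm_I_le[OF p(1)] norm_ge_zero[of "I p"] \<open>d > 0\<close> unfolding M_def by linarith
  define \<mu> where "\<mu> x = (if x \<in> A then of_real (inverse M) * conj (w x) else 0)" for x
  have pair: "lincomb (*) \<mu> h = of_real (inverse M) * I h" for h
    by (subst pairing_superset[OF A(1)]) (auto simp: \<mu>_def I_def sum_distrib_left mult.assoc)
  have norm_pair: "norm (lincomb (*) \<mu> h) = norm (I h) / M" for h
    unfolding pair norm_mult norm_of_real using \<open>M > 0\<close> by (simp add: divide_inverse)
  show thesis
  proof
    show "\<mu> \<in> finsupp S"
      using A(1,2) by (auto simp: finsupp_def \<mu>_def intro: finite_subset[OF _ A(1)])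
    show "norm (lincomb (*) \<mu> h) \<le> 1" if "h \<in> K" for h
      using norm_I_le[OF that] \<open>d > 0\<close> \<open>M > 0\<close> by (simp add: norm_pair) (simp add: M_def)
    show "norm (lincomb (*) \<mu> z) > 1"
      using \<open>norm (I z) > _\<close> \<open>M > 0\<close> by (simp add: norm_pair flip: M_def)
  qed
qed

text \<open>For \<open>x\<close> in \<open>U\<close> the Dirac measure at \<open>x\<close> does it.
  Otherwise uniqueness prevents any element of \<open>K\<close> from vanishing on \<open>U\<close>
  while taking the value \<open>\<epsilon>\<close> at \<open>x\<close>. A measure on
  \<open>insert x U\<close> separating this target from \<open>K\<close> has a mass of norm above
  \<open>1 / \<epsilon>\<close> at \<open>x\<close>, and dividing by this mass leaves an
  approximation of the evaluation by a measure on \<open>U\<close>.\<close>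

lemma evaluation_approximation:
  fixes K :: "('x \<Rightarrow> 'k::real_or_complex) set"
  assumes "compact K" "absolutely_convex fun_smul K" "K \<noteq> {}"
    and "set_of_uniqueness \<F> U" "K \<subseteq> \<F>" "\<epsilon> > 0"
  obtains \<mu> where "\<mu> \<in> finsupp U" "\<And>h. h \<in> K \<Longrightarrow> norm (h x - lincomb (*) \<mu> h) \<le> \<epsilon>"
proof (cases "x \<in> U")
  case True
  define \<mu> :: "'x \<Rightarrow> 'k" where "\<mu> = (\<lambda>y. if y = x then 1 else 0)"
  have "lincomb (*) \<mu> h = h x" for h
    by (subst pairing_superset[of "{x}"]) (auto simp: \<mu>_def)
  moreover have "\<mu> \<in> finsupp U" using True by (auto simp: finsupp_def \<mu>_def)
  ultimately show thesis using that assms(6) by simp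
next
  case False
  define z where "z = (\<lambda>y. if y = x then of_real \<epsilon> else 0 :: 'k)"
  have "\<not> (\<exists>h\<in>K. \<forall>y\<in>insert x U. h y = z y)"
  proof
    assume "\<exists>h\<in>K. \<forall>y\<in>insert x U. h y = z y"
    then obtain h where h: "h \<in> K" "\<And>y. y \<in> insert x U \<Longrightarrow> h y = z y" by blast
    then have "\<forall>y\<in>U. h y = 0" using False by (auto simp: z_def)
    then have "h x = 0" using h(1) assms(4,5) unfolding set_of_uniqueness_def by blast
    with h(2)[of x] assms(6) show False by (simp add: z_def)
  qed
  then obtain \<mu> where \<mu>: "\<mu> \<in> finsupp (insert x U)"
    "\<And>h. h \<in> K \<Longrightarrow> norm (lincomb (*) \<mu> h) \<le> 1" "norm (lincomb (*) \<mu> z) > 1"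
    using separation_compact_absolutely_convex[OF assms(1-3)] by metis
  define A where "A = {y. \<mu> y \<noteq> 0} - {x}"
  have A: "finite A" "A \<subseteq> U" "x \<notin> A" "{y. \<mu> y \<noteq> 0} \<subseteq> insert x A"
    using \<mu>(1) by (auto simp: finsupp_def A_def)
  have pair: "lincomb (*) \<mu> h = \<mu> x * h x + (\<Sum>y\<in>A. \<mu> y * h y)" for h
    using A by (subst pairing_superset[of "insert x A"]) auto
  have "(\<Sum>y\<in>A. \<mu> y * z y) = 0"
    using A(3) by (intro sum.neutral) (auto simp: z_def)
  then have gt: "norm (\<mu> x) * \<epsilon> > 1"
    using \<mu>(3) assms(6) by (simp add: pair norm_mult z_def)
  then have nz: "\<mu> x \<noteq> 0" by auto
  \<comment> \<open>The part of \<open>\<mu>\<close> away from \<open>x\<close>, normalised and with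
    reversed sign, so that the Dirac measure at \<open>x\<close> minus \<open>\<nu>\<close> is
    \<open>\<mu>\<close> divided by \<open>\<mu> x\<close>.\<close>
  define \<nu> where "\<nu> y = (if y \<in> A then - \<mu> y / \<mu> x else 0)" for y
  have "h x - lincomb (*) \<nu> h = lincomb (*) \<mu> h / \<mu> x" for h
    unfolding pair by (subst pairing_superset[OF A(1)])
      (auto simp: \<nu>_def add_divide_distrib sum_divide_distrib sum_negf nz)
  moreover have "norm (lincomb (*) \<mu> h / \<mu> x) \<le> \<epsilon>" if "h \<in> K" for h
  proof -
    have "norm (lincomb (*) \<mu> h) \<le> norm (\<mu> x) * \<epsilon>" using \<mu>(2)[OF that] gt by linarith
    then show ?thesis using nz by (simp add: norm_divide field_simps)
  qed
  moreover have "\<nu> \<in> finsupp U"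
    using A(1,2) by (auto simp: finsupp_def \<nu>_def intro: finite_subset[OF _ A(1)])
  ultimately show thesis using that by metis
qed

section \<open>Bounded sets and duals\<close>

lemma absorbs_Un:
  assumes "absorbs smul W A" "absorbs smul W B"
  shows "absorbs smul W (A \<union> B)"
proof -
  obtain r s where "r > 0" "\<forall>c. r \<le> norm c \<longrightarrow> A \<subseteq> smul c ` W"
    "s > 0" "\<forall>c. s \<le> norm c \<longrightarrow> B \<subseteq> smul c ` W"
    using assms unfolding absorbs_def by blast
  then show ?thesis
    unfolding absorbs_def by (intro exI[of _ "max r s"]) auto
qed

lemma tvs_bounded_Un:
  "tvs_bounded smul T A \<Longrightarrow> tvs_bounded smul T B \<Longrightarrow> tvs_bounded smul T (A \<union> B)"
  unfolding tvs_bounded_def by (auto intro: absorbs_Un)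

text \<open>Scalar multiplication is continuous at 0 along \<open>v\<close>, so small multiples of
  \<open>v\<close> lie in any given zero neighbourhood.\<close>

lemma tvs_bounded_singleton:
  fixes smul :: "'k::real_or_complex \<Rightarrow> 'v::ab_group_add \<Rightarrow> 'v"
  assumes "topological_vector_space smul T" "v \<in> topspace T"
  shows "tvs_bounded smul T {v}"
  unfolding tvs_bounded_def
proof (intro conjI allI impI)
  interpret vector_space smul using assms(1) by (simp add: topological_vector_space_def)
  fix W assume "zero_neighbourhood T W"
  then obtain S where S: "openin T S" "0 \<in> S" "S \<subseteq> W"
    unfolding zero_neighbourhood_def by blast
  have "continuous_map (prod_topology euclidean T) T (\<lambda>(c, x). smul c x)"
    using assms(1) by (simp add: topological_vector_space_def)
  moreover have "continuous_map euclidean (prod_topology euclidean T) (\<lambda>c. (c, v))"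
    using assms(2) by (simp add: continuous_map_pairedI)
  ultimately have "continuous_map euclidean T ((\<lambda>(c, x). smul c x) \<circ> (\<lambda>c. (c, v)))"
    by (rule continuous_map_compose[rotated])
  then have "open {c. smul c v \<in> S}"
    using S(1) by (auto simp: continuous_map_def o_def)
  moreover have "0 \<in> {c. smul c v \<in> S}" using S(2) by simp
  ultimately obtain \<epsilon> where \<epsilon>: "\<epsilon> > 0" "\<And>c. norm c < \<epsilon> \<Longrightarrow> smul c v \<in> S"
    unfolding open_dist by (metis dist_0_norm dist_commute mem_Collect_eq)
  show "absorbs smul W {v}"
    unfolding absorbs_def
  \<comment> \<open>The factor 2 makes the norm of \<open>inverse c\<close> at most
    \<open>\<epsilon> / 2\<close>, hence strictly below \<open>\<epsilon>\<close>.\<close>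
  proof (intro exI[of _ "2 / \<epsilon>"] conjI allI impI subsetI)
    fix c :: 'k and u assume c: "2 / \<epsilon> \<le> norm c" and "u \<in> {v}"
    then have "c \<noteq> 0" using \<epsilon>(1) by auto
    then have "norm (inverse c) < \<epsilon>"
      using c \<epsilon>(1) \<open>c \<noteq> 0\<close> by (auto simp: norm_divide inverse_eq_divide divide_simps mult.commute)
    then have "smul (inverse c) v \<in> W" using \<epsilon>(2) S(3) by blast
    moreover have "u = smul c (smul (inverse c) v)" using \<open>c \<noteq> 0\<close> \<open>u \<in> {v}\<close> by simp
    ultimately show "u \<in> smul c ` W" by blast
  qed (use \<epsilon> in auto)
qed (use assms(2) in auto)

text \<open>Linearity of \<open>\<phi>\<close>, which moves questions about T in E to scalar
  pairings. For infinite support both sides are 0 by the convention for sums.\<close>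

lemma topological_dual_lincomb:
  fixes smul :: "'k::real_or_complex \<Rightarrow> 'e::ab_group_add \<Rightarrow> 'e"
  assumes "topspace T = UNIV" "\<phi> \<in> topological_dual smul T"
  shows "\<phi> (lincomb smul \<mu> g) = lincomb (*) \<mu> (\<phi> \<circ> g)"
proof -
  have add: "\<phi> (u + v) = \<phi> u + \<phi> v" and scale: "\<phi> (smul c u) = c * \<phi> u" for u v c
    using assms unfolding topological_dual_def by auto
  have "\<phi> 0 = 0" using add[of 0 0] by simp
  then have "\<phi> (\<Sum>x\<in>A. smul (\<mu> x) (g x)) = (\<Sum>x\<in>A. \<mu> x * \<phi> (g x))" for A
    by (induction A rule: infinite_finite_induct) (simp_all add: add scale)
  then show ?thesis by (simp add: lincomb_def)
qed

text \<open>If \<open>G\<close> does not distinguish \<open>u\<close> from \<open>v\<close>, every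
  element of \<open>G\<close> vanishes on the line spanned by \<open>u - v\<close>. That line is
  then bounded, which is impossible in a Hausdorff space unless \<open>u = v\<close>.\<close>

lemma determines_boundedness_separates:
  fixes smul :: "'k::real_or_complex \<Rightarrow> 'e::ab_group_add \<Rightarrow> 'e"
  assumes "locally_convex_hausdorff smul T" "topspace T = UNIV"
    and "G \<subseteq> topological_dual smul T" "determines_boundedness smul T G"
    and "\<And>\<phi>. \<phi> \<in> G \<Longrightarrow> \<phi> u = \<phi> v"
  shows "u = v"
proof (rule ccontr)
  assume "u \<noteq> v"
  define w where "w = u - v"
  have "w \<noteq> 0" using \<open>u \<noteq> v\<close> by (simp add: w_def)
  interpret vector_space smul
    using assms(1) by (simp add: locally_convex_hausdorff_def topological_vector_space_def)
  have "\<phi> (smul c w) = 0" if "\<phi> \<in> G" for \<phi> c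
  proof -
    have \<phi>: "\<phi> (x + y) = \<phi> x + \<phi> y" "\<phi> (smul c x) = c * \<phi> x" for x y c
      using assms(2,3) that unfolding topological_dual_def by auto
    show ?thesis using \<phi>(1)[of w v] assms(5)[OF that] by (simp add: \<phi>(2) w_def)
  qed
  then have "\<forall>\<phi>\<in>G. \<exists>C. \<forall>x\<in>range (\<lambda>c. smul c w). norm (\<phi> x) \<le> C"
    by (intro ballI exI[of _ 0]) auto
  then have bdd: "tvs_bounded smul T (range (\<lambda>c. smul c w))"
    using assms(2,4) unfolding determines_boundedness_def by simp
  obtain S where S: "openin T S" "0 \<in> S" "w \<notin> S"
    using assms(1,2) \<open>w \<noteq> 0\<close> unfolding locally_convex_hausdorff_def Hausdorff_space_def
    by (metis UNIV_I disjnt_iff)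
  then have "zero_neighbourhood T S" using assms(2) by (auto simp: zero_neighbourhood_def)
  then obtain r where r: "r > 0" "\<And>c. r \<le> norm c \<Longrightarrow> range (\<lambda>c. smul c w) \<subseteq> smul c ` S"
    using bdd unfolding tvs_bounded_def absorbs_def by metis
  \<comment> \<open>A nonzero scalar large enough for absorption: \<open>smul c w\<close> is on the
    line, hence in \<open>smul c\<close> applied to \<open>S\<close>, and cancelling
    \<open>c\<close> puts \<open>w\<close> into \<open>S\<close>.\<close>
  define c where "c = (of_real r :: 'k)"
  have "c \<noteq> 0" "r \<le> norm c" using r(1) by (auto simp: c_def)
  then have "smul c w \<in> smul c ` S" using r(2) by blast
  then show False using S(3) \<open>c \<noteq> 0\<close> by auto
qed

lemma compact_coarser_pointwise:
  fixes T' :: "('x \<Rightarrow> 'k::real_or_complex) topology"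
  assumes "coarser_topology (pointwise_topology \<F>) T'" "compactin T' K"
  shows "compact K"
proof -
  have "compactin (pointwise_topology \<F>) K"
    using assms unfolding coarser_topology_def by (metis compactin_contractive)
  then show ?thesis
    unfolding pointwise_topology_def compactin_subtopology
    by (metis compactin_euclidean_iff euclidean_product_topology)
qed

text \<open>The first members of a fundamental sequence of bounded sets have bounded union, which
  (BBC) encloses in a compact absolutely convex set. These enclosures are chosen independently for
  each index and need not increase, hence the form "contained in all \<open>K j\<close> from some
  index on".\<close>

lemma pointwise_compact_exhaustion:
  fixes \<tau> \<tau>' :: "('x \<Rightarrow> 'k::real_or_complex) topology"
  assumes "DF_space fun_smul \<tau>" "BBC fun_smul \<tau> \<tau>'"
    and "coarser_topology (pointwise_topology \<F>) \<tau>'"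
  obtains K :: "nat \<Rightarrow> ('x \<Rightarrow> 'k) set" where
    "\<And>n. compact (K n)" "\<And>n. absolutely_convex fun_smul (K n)"
    "\<And>n. K n \<noteq> {}" "\<And>n. K n \<subseteq> topspace \<tau>"
    "\<And>n. \<exists>m. \<forall>j\<ge>m. K n \<subseteq> K j" "\<And>h. h \<in> topspace \<tau> \<Longrightarrow> \<exists>m. \<forall>j\<ge>m. h \<in> K j"
proof -
  have tvs: "topological_vector_space fun_smul \<tau>"
    using assms(1) by (simp add: DF_space_def locally_convex_hausdorff_def)
  then have zero_in: "0 \<in> topspace \<tau>"
    unfolding topological_vector_space_def
    by (metis module.subspace_0 module_iff_vector_space)
  obtain B :: "nat \<Rightarrow> ('x \<Rightarrow> 'k) set" where B: "\<And>n. tvs_bounded fun_smul \<tau> (B n)"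
    "\<And>A. tvs_bounded fun_smul \<tau> A \<Longrightarrow> \<exists>n. A \<subseteq> B n"
    using assms(1) unfolding DF_space_def by blast
  \<comment> \<open>Including 0 makes every \<open>K n\<close> nonempty.\<close>
  have "tvs_bounded fun_smul \<tau> ({0} \<union> (\<Union>i\<le>n. B i))" for n
  proof (induction n)
    case 0
    show ?case using tvs_bounded_Un[OF tvs_bounded_singleton[OF tvs zero_in] B(1)[of 0]]
      by (simp add: zero_fun_def)
  next
    case (Suc n)
    have "{0} \<union> (\<Union>i\<le>Suc n. B i) = ({0} \<union> (\<Union>i\<le>n. B i)) \<union> B (Suc n)"
      by (auto simp: atMost_Suc)
    with tvs_bounded_Un[OF Suc B(1)] show ?case by metis
  qed
  then have "\<forall>n. \<exists>K. {0} \<union> (\<Union>i\<le>n. B i) \<subseteq> K \<and> absolutely_convex fun_smul K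
      \<and> tvs_bounded fun_smul \<tau> K \<and> compactin \<tau>' K"
    using assms(2) unfolding BBC_def by blast
  then obtain K where K: "\<And>n. {0} \<union> (\<Union>i\<le>n. B i) \<subseteq> K n" "\<And>n. absolutely_convex fun_smul (K n)"
    "\<And>n. tvs_bounded fun_smul \<tau> (K n)" "\<And>n. compactin \<tau>' (K n)"
    by metis
  have absorbed: "\<exists>m. \<forall>j\<ge>m. A \<subseteq> K j" if A: "tvs_bounded fun_smul \<tau> A" for A
  proof -
    obtain m where "A \<subseteq> B m" using B(2)[OF A] by blast
    moreover have "B m \<subseteq> K j" if "j \<ge> m" for j using K(1)[of j] that by blast
    ultimately show ?thesis by blast
  qed
  show thesis
  proof
    show "compact (K n)" for n using compact_coarser_pointwise assms(3) K(4) by blast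
    show "absolutely_convex fun_smul (K n)" for n by (rule K(2))
    show "K n \<noteq> {}" for n using K(1) by blast
    show "K n \<subseteq> topspace \<tau>" for n using K(3) by (simp add: tvs_bounded_def)
    show "\<exists>m. \<forall>j\<ge>m. K n \<subseteq> K j" for n using absorbed K(3) by blast
    show "\<exists>m. \<forall>j\<ge>m. h \<in> K j" if "h \<in> topspace \<tau>" for h
      using absorbed[OF tvs_bounded_singleton[OF tvs that]] by simp
  qed
qed

section \<open>The extension\<close>

text \<open>Otherwise there are measures \<open>\<mu> n\<close>, of size at most
  \<open>1 / Suc n\<close> on \<open>K n\<close>, whose images under T avoid \<open>W\<close>. The
  images multiplied by \<open>Suc n\<close> are still bounded under every element of
  \<open>G\<close>, hence bounded in E, and absorption by \<open>W\<close> gives a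
  contradiction.\<close>

lemma continuity_of_lincomb:
  fixes f :: "'x \<Rightarrow> 'e::ab_group_add" and smul :: "'k::real_or_complex \<Rightarrow> 'e \<Rightarrow> 'e"
    and K :: "nat \<Rightarrow> ('x \<Rightarrow> 'k) set"
  assumes "topspace T = UNIV" "vector_space smul"
    and "G \<subseteq> topological_dual smul T" "determines_boundedness smul T G"
    and "\<And>e'. e' \<in> G \<Longrightarrow> \<exists>h\<in>\<F>. \<forall>x\<in>U. h x = e' (f x)"
    and "\<And>h. h \<in> \<F> \<Longrightarrow> \<exists>m. \<forall>j\<ge>m. h \<in> K j"
    and "zero_neighbourhood T W"
  obtains n where "\<And>\<mu>. \<mu> \<in> finsupp U \<Longrightarrow>
    (\<And>h. h \<in> K n \<Longrightarrow> norm (lincomb (*) \<mu> h) \<le> 1 / real (Suc n)) \<Longrightarrow> lincomb smul \<mu> f \<in> W"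
proof (rule ccontr)
  interpret vector_space smul by (rule assms(2))
  assume "\<not> thesis"
  with that have "\<forall>n. \<exists>\<mu>. \<mu> \<in> finsupp U \<and> (\<forall>h\<in>K n. norm (lincomb (*) \<mu> h) \<le> 1 / real (Suc n))
      \<and> lincomb smul \<mu> f \<notin> W"
    by blast
  then obtain \<mu> where \<mu>: "\<And>n. \<mu> n \<in> finsupp U"
    "\<And>n h. h \<in> K n \<Longrightarrow> norm (lincomb (*) (\<mu> n) h) \<le> 1 / real (Suc n)"
    "\<And>n. lincomb smul (\<mu> n) f \<notin> W"
    by metis
  define v where "v n = smul (of_nat (Suc n)) (lincomb smul (\<mu> n) f)" for n
  have "\<exists>C. \<forall>x\<in>range v. norm (\<phi> x) \<le> C" if "\<phi> \<in> G" for \<phi>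
  proof -
    note \<phi>G = that
    obtain h where h: "h \<in> \<F>" "\<And>x. x \<in> U \<Longrightarrow> h x = \<phi> (f x)" using assms(5)[OF \<phi>G] by blast
    obtain m where m: "\<And>j. j \<ge> m \<Longrightarrow> h \<in> K j" using assms(6) h(1) by blast
    have \<phi>: "\<phi> \<in> topological_dual smul T" using \<phi>G assms(3) by blast
    have \<phi>v: "\<phi> (v n) = of_nat (Suc n) * lincomb (*) (\<mu> n) h" for n
    proof -
      have "\<phi> (v n) = of_nat (Suc n) * lincomb (*) (\<mu> n) (\<phi> \<circ> f)"
        unfolding v_def using \<phi> assms(1) topological_dual_lincomb[OF assms(1) \<phi>, of "\<mu> n" f]
        by (simp add: topological_dual_def)
      then show ?thesis using pairing_cong[OF \<mu>(1), of "\<phi> \<circ> f" h] h(2) by simp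
    qed
    \<comment> \<open>The bound 1 holds once \<open>h\<close> lies in \<open>K n\<close>, that is
      for \<open>n \<ge> m\<close>; the finitely many earlier terms are covered by their
      sum.\<close>
    have "norm (\<phi> (v n)) \<le> 1 + (\<Sum>i<m. norm (\<phi> (v i)))" for n
    proof (cases "n < m")
      case True
      then have "norm (\<phi> (v n)) \<le> (\<Sum>i<m. norm (\<phi> (v i)))"
        by (intro member_le_sum) auto
      then show ?thesis by simp
    next
      case False
      then have "norm (\<phi> (v n)) \<le> 1"
        using \<mu>(2)[OF m, of n] by (simp only: \<phi>v norm_mult norm_of_nat) (simp add: field_simps)
      moreover have "0 \<le> (\<Sum>i<m. norm (\<phi> (v i)))" by (intro sum_nonneg) simp
      ultimately show ?thesis by simp
    qed
    then show ?thesis by blast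
  qed
  then have "tvs_bounded smul T (range v)"
    using assms(1,4) unfolding determines_boundedness_def by simp
  then obtain r where r: "\<And>c. r \<le> norm c \<Longrightarrow> range v \<subseteq> smul c ` W"
    using assms(7) unfolding tvs_bounded_def absorbs_def by metis
  obtain n where "r \<le> real n" using real_arch_simple by blast
  then have "r \<le> norm (of_nat (Suc n) :: 'k)" by (simp only: norm_of_nat)
  then have "v n \<in> smul (of_nat (Suc n)) ` W" using r by blast
  then have "lincomb smul (\<mu> n) f \<in> W"
    unfolding v_def by (auto simp del: of_nat_Suc)
  with \<mu>(3) show False by blast
qed

theorem theorem4p8:
  fixes \<F> :: "('x \<Rightarrow> 'k::real_or_complex) set"
    and \<tau> \<tau>' :: "('x \<Rightarrow> 'k) topology"
    and U :: "'x set"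
    and smulE :: "'k \<Rightarrow> 'e::ab_group_add \<Rightarrow> 'e"
    and TE :: "'e topology"
    and G :: "('e \<Rightarrow> 'k) set"
    and f :: "'x \<Rightarrow> 'e"
  assumes "topspace \<tau> = \<F>"
    and "DF_space fun_smul \<tau>"
    and "bornological fun_smul \<tau>"
    and "tvs_complete \<tau>"
    and "topspace \<tau>' = \<F>"
    and "locally_convex_hausdorff fun_smul \<tau>'"
    and "coarser_topology (pointwise_topology \<F>) \<tau>'"
    and "BBC fun_smul \<tau> \<tau>'"
    and "CNC fun_smul \<tau> \<tau>'"
    and "set_of_uniqueness \<F> U"
    and "topspace TE = UNIV"
    and "locally_convex_hausdorff smulE TE"
    and "tvs_complete TE"
    and "G \<subseteq> topological_dual smulE TE"
    and "module.subspace fun_smul G"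
    and "determines_boundedness smulE TE G"
    and "\<And>e'. e' \<in> G \<Longrightarrow> \<exists>h\<in>\<F>. \<forall>x\<in>U. h x = e' (f x)"
  shows "\<exists>!F. F \<in> weak_vector_valued \<F> smulE TE \<and> (\<forall>x\<in>U. F x = f x)"
proof -

  \<comment> \<open>Linear structure of \<open>\<F>\<close> and separation of points by
    \<open>U\<close> and \<open>G\<close>\<close>
  have vsE: "vector_space smulE"
    using assms(12) by (simp add: locally_convex_hausdorff_def topological_vector_space_def)
  have subF: "module.subspace fun_smul \<F>"
    using assms(1,2) unfolding DF_space_def locally_convex_hausdorff_def topological_vector_space_def
    by blast
  have F_smul: "fun_smul c h \<in> \<F>" if "h \<in> \<F>" for c h
    using subF that by (metis module.subspace_scale module_iff_vector_space vector_space_fun_smul)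
  have F_diff: "h - g \<in> \<F>" if "h \<in> \<F>" "g \<in> \<F>" for h g
    using subF that by (metis module.subspace_diff module_iff_vector_space vector_space_fun_smul)
  have F_eqI: "h = g" if "h \<in> \<F>" "g \<in> \<F>" "\<And>x. x \<in> U \<Longrightarrow> h x = g x" for h g
    using F_diff[OF that(1,2)] that(3) assms(10) unfolding set_of_uniqueness_def
    by (auto simp: fun_eq_iff)
  have G_eqI: "u = v" if "\<And>e'. e' \<in> G \<Longrightarrow> e' u = e' v" for u v
    using determines_boundedness_separates[OF assms(12,11,14,16)] that by blast

  \<comment> \<open>Compact exhaustion of \<open>\<F>\<close> and continuity of T\<close>
  obtain K :: "nat \<Rightarrow> ('x \<Rightarrow> 'k) set" where
    K: "\<And>n. compact (K n)" "\<And>n. absolutely_convex fun_smul (K n)" "\<And>n. K n \<noteq> {}"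
    and K_F: "\<And>n. K n \<subseteq> \<F>"
    and K_mono: "\<And>n. \<exists>m. \<forall>j\<ge>m. K n \<subseteq> K j"
    and K_cover: "\<And>h. h \<in> \<F> \<Longrightarrow> \<exists>m. \<forall>j\<ge>m. h \<in> K j"
    using pointwise_compact_exhaustion[OF assms(2,8,7)] unfolding assms(1) by metis
  have cont: "\<exists>n. \<forall>\<mu>\<in>finsupp U. (\<forall>h\<in>K n. norm (lincomb (*) \<mu> h) \<le> 1 / real (Suc n)) \<longrightarrow>
      lincomb smulE \<mu> f \<in> W" if "zero_neighbourhood TE W" for W
  proof -
    obtain n where "\<And>\<mu>. \<mu> \<in> finsupp U \<Longrightarrow>
        (\<And>h. h \<in> K n \<Longrightarrow> norm (lincomb (*) \<mu> h) \<le> 1 / real (Suc n)) \<Longrightarrow> lincomb smulE \<mu> f \<in> W"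
      using continuity_of_lincomb[where U = U and K = K and f = f,
          OF assms(11) vsE assms(14,16) assms(17) K_cover \<open>zero_neighbourhood TE W\<close>] by blast
    then show ?thesis by blast
  qed

  \<comment> \<open>Point evaluations as limits of measures on \<open>U\<close>, and the function
    \<open>F\<close>\<close>
  have "\<forall>x j. \<exists>\<mu>. \<mu> \<in> finsupp U \<and>
      (\<forall>h\<in>K j. norm (h x - lincomb (*) \<mu> h) \<le> 1 / (2 * real (Suc j)))"
  proof (intro allI)
    fix x and j :: nat
    have "0 < 1 / (2 * real (Suc j))" by simp
    then show "\<exists>\<mu>. \<mu> \<in> finsupp U \<and>
        (\<forall>h\<in>K j. norm (h x - lincomb (*) \<mu> h) \<le> 1 / (2 * real (Suc j)))"
      using evaluation_approximation[OF K assms(10) K_F, of _ j x] by metis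
  qed
  \<comment> \<open>The tolerance is half of the bound in \<open>cont\<close>, so that a difference
    of two approximating measures meets that bound.\<close>
  then obtain \<mu> where \<mu>: "\<And>x j. \<mu> x j \<in> finsupp U"
    "\<And>x j h. h \<in> K j \<Longrightarrow> norm (h x - lincomb (*) (\<mu> x j) h) \<le> 1 / (2 * real (Suc j))"
    by metis
  define v where "v x j = lincomb smulE (\<mu> x j) f" for x j
  have "\<exists>l. limitin TE (v x) l sequentially" for x
  proof -
    have "tvs_cauchy_filter TE (filtermap (v x) sequentially)"
      unfolding tvs_cauchy_filter_def
    proof (intro conjI allI impI)
      fix W assume "zero_neighbourhood TE W"
      then obtain n where n: "\<And>\<mu>. \<mu> \<in> finsupp U \<Longrightarrow>
          (\<And>h. h \<in> K n \<Longrightarrow> norm (lincomb (*) \<mu> h) \<le> 1 / real (Suc n)) \<Longrightarrow> lincomb smulE \<mu> f \<in> W"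
        using cont by metis
      obtain m where m: "\<And>j. j \<ge> m \<Longrightarrow> K n \<subseteq> K j" using K_mono by blast
      \<comment> \<open>Beyond \<open>m\<close> the approximation is valid on all of
        \<open>K n\<close>, and beyond \<open>n\<close> its error is small enough for
        \<open>cont\<close>.\<close>
      have *: "v x i - v x j \<in> W" if ij: "i \<ge> max m n" "j \<ge> max m n" for i j
      proof -
        have "norm (lincomb (*) (\<lambda>y. \<mu> x i y - \<mu> x j y) h) \<le> 1 / real (Suc n)" if h: "h \<in> K n" for h
        proof -
          have le: "norm (h x - lincomb (*) (\<mu> x k) h) \<le> 1 / (2 * real (Suc n))"
            if "k \<ge> max m n" for k
          proof -
            have "h \<in> K k" using m h that by auto
            then have "norm (h x - lincomb (*) (\<mu> x k) h) \<le> 1 / (2 * real (Suc k))" by (rule \<mu>(2))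
            also have "\<dots> \<le> 1 / (2 * real (Suc n))" using that by (intro frac_le) auto
            finally show ?thesis .
          qed
          have "norm (lincomb (*) (\<lambda>y. \<mu> x i y - \<mu> x j y) h)
              = norm ((h x - lincomb (*) (\<mu> x j) h) - (h x - lincomb (*) (\<mu> x i) h))"
            by (simp add: pairing_diff[OF \<mu>(1) \<mu>(1)])
          also have "\<dots> \<le> 1 / (2 * real (Suc n)) + 1 / (2 * real (Suc n))"
            by (intro norm_triangle_le_diff add_mono le ij)
          also have "\<dots> = 1 / real (Suc n)" by (simp add: field_simps)
          finally show ?thesis .
        qed
        then have "lincomb smulE (\<lambda>y. \<mu> x i y - \<mu> x j y) f \<in> W"
          using n finsupp_diff[OF \<mu>(1) \<mu>(1)] by blast
        then show ?thesis by (simp add: v_def vector_space.lincomb_diff[OF vsE \<mu>(1) \<mu>(1)])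
      qed
      have "\<forall>\<^sub>F k in sequentially. k \<ge> max m n" by (rule eventually_ge_at_top)
      then have "\<forall>\<^sub>F u in filtermap (v x) sequentially. \<exists>k\<ge>max m n. u = v x k"
        unfolding eventually_filtermap by (rule eventually_mono) blast
      then have "\<forall>\<^sub>F p in filtermap (v x) sequentially \<times>\<^sub>F filtermap (v x) sequentially.
          (\<exists>k\<ge>max m n. fst p = v x k) \<and> (\<exists>k\<ge>max m n. snd p = v x k)"
        by (intro eventually_prodI)
      then show "\<forall>\<^sub>F (u, w) in filtermap (v x) sequentially \<times>\<^sub>F filtermap (v x) sequentially. u - w \<in> W"
        by (rule eventually_mono) (use * in auto)
    qed (simp_all add: filtermap_bot_iff assms(11))
    then obtain l where "limitin TE (\<lambda>u. u) l (filtermap (v x) sequentially)"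
      using assms(13) unfolding tvs_complete_def by blast
    then show ?thesis
      by (auto simp: limitin_def eventually_filtermap)
  qed
  then obtain F where F: "\<And>x. limitin TE (v x) (F x) sequentially" by metis

  \<comment> \<open>Functionals in the dual of E composed with \<open>F\<close>\<close>
  have represent: "\<exists>h\<in>\<F>. (\<forall>x\<in>U. h x = e' (f x)) \<and> h = e' \<circ> F"
    if e': "e' \<in> topological_dual smulE TE" for e'
  proof -
    have e'_cont: "continuous_map TE euclidean e'"
      using e' by (simp add: topological_dual_def)
    have "e' (0 + 0) = e' 0 + e' 0"
      using e' assms(11) unfolding topological_dual_def by blast
    then have "e' 0 = 0" by simp
    have "zero_neighbourhood TE {u. norm (e' u) < 1}"
      unfolding zero_neighbourhood_def
    proof (intro conjI exI)
      show "openin TE {u. norm (e' u) < 1}"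
        using openin_continuous_map_preimage[OF e'_cont, of "ball 0 1"] assms(11) by simp
    qed (use \<open>e' 0 = 0\<close> assms(11) in auto)
    then obtain n where n: "\<And>\<mu>. \<mu> \<in> finsupp U \<Longrightarrow>
        (\<And>h. h \<in> K n \<Longrightarrow> norm (lincomb (*) \<mu> h) \<le> 1 / real (Suc n)) \<Longrightarrow>
        lincomb smulE \<mu> f \<in> {u. norm (e' u) < 1}"
      using cont by metis
    \<comment> \<open>By the choice of \<open>n\<close>, measures bounded by
      \<open>1 / Suc n\<close> on \<open>K n\<close> have images where \<open>e'\<close> is below 1
      in norm. So \<open>c\<close> times \<open>e' \<circ> f\<close> must agree on \<open>U\<close>
      with an element of \<open>K n\<close>: a separating \<open>\<nu>\<close>, scaled by
      \<open>c\<close>, would violate this bound.\<close>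
    define c where "c = (inverse (of_nat (Suc n)) :: 'k)"
    have c: "c \<noteq> 0" "norm c = 1 / real (Suc n)"
      unfolding c_def by (simp_all add: norm_divide inverse_eq_divide del: of_nat_Suc)
    have "\<exists>h\<in>K n. \<forall>x\<in>U. h x = c * e' (f x)"
    proof (rule ccontr)
      assume "\<not> ?thesis"
      then obtain \<nu> where \<nu>: "\<nu> \<in> finsupp U" "\<And>h. h \<in> K n \<Longrightarrow> norm (lincomb (*) \<nu> h) \<le> 1"
        "norm (lincomb (*) \<nu> (\<lambda>x. c * e' (f x))) > 1"
        using separation_compact_absolutely_convex[OF K, of n U "\<lambda>x. c * e' (f x)"] by metis
      have "lincomb smulE (\<lambda>x. c * \<nu> x) f \<in> {u. norm (e' u) < 1}"
      proof (rule n)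
        show "(\<lambda>x. c * \<nu> x) \<in> finsupp U" using \<nu>(1) by (rule finsupp_scale)
        show "norm (lincomb (*) (\<lambda>x. c * \<nu> x) h) \<le> 1 / real (Suc n)" if "h \<in> K n" for h
          using mult_left_mono[OF \<nu>(2)[OF that], of "norm c"] c(2)
          by (simp add: pairing_scale[OF \<nu>(1)] norm_mult)
      qed
      then have "norm (c * lincomb (*) \<nu> (e' \<circ> f)) < 1"
        by (simp add: topological_dual_lincomb[OF assms(11) e'] pairing_scale[OF \<nu>(1)])
      with \<nu>(3) show False by (simp add: pairing_scale_right o_def)
    qed
    then obtain g where g: "g \<in> K n" "\<And>x. x \<in> U \<Longrightarrow> g x = c * e' (f x)" by blast
    define h where "h = fun_smul (inverse c) g"
    have hF: "h \<in> \<F>" unfolding h_def using g(1) K_F by (intro F_smul) blast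
    have hU: "h x = e' (f x)" if "x \<in> U" for x
      using g(2)[OF that] c(1) by (simp add: h_def fun_smul_def)
    obtain m where m: "\<And>j. j \<ge> m \<Longrightarrow> h \<in> K j" using K_cover hF by blast
    \<comment> \<open>The pairings of \<open>\<mu> x j\<close> with \<open>h\<close> tend to
      \<open>e' (F x)\<close> by continuity of \<open>e'\<close>, and to \<open>h x\<close> by the
      choice of \<open>\<mu> x j\<close>, since \<open>h\<close> is in \<open>K j\<close> for all
      large \<open>j\<close>.\<close>
    have "e' (F x) = h x" for x
    proof -
      have e'v: "e' (v x j) = lincomb (*) (\<mu> x j) h" for j
        unfolding v_def topological_dual_lincomb[OF assms(11) e']
        using hU by (intro pairing_cong[OF \<mu>(1)]) auto
      have "limitin euclidean (e' \<circ> v x) (e' (F x)) sequentially"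
        by (rule continuous_map_limit[OF e'_cont F])
      then have lim1: "(\<lambda>j. lincomb (*) (\<mu> x j) h) \<longlonglongrightarrow> e' (F x)" by (simp add: o_def e'v)
      have "(\<lambda>j. h x - lincomb (*) (\<mu> x j) h) \<longlonglongrightarrow> 0"
      proof (rule Lim_null_comparison)
        show "\<forall>\<^sub>F j in sequentially. norm (h x - lincomb (*) (\<mu> x j) h) \<le> 1 / 2 * (1 / real (Suc j))"
          using eventually_ge_at_top[of m] by (rule eventually_mono) (use \<mu>(2)[OF m] in simp)
        show "(\<lambda>j. 1 / 2 * (1 / real (Suc j))) \<longlonglongrightarrow> 0"
          by (intro tendsto_mult_right_zero lim_1_over_n[THEN LIMSEQ_Suc])
      qed
      then have "(\<lambda>j. h x - (h x - lincomb (*) (\<mu> x j) h)) \<longlonglongrightarrow> h x - 0" by (intro tendsto_intros)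
      with lim1 show ?thesis using LIMSEQ_unique by fastforce
    qed
    then show ?thesis using hF hU by (intro bexI[of _ h]) auto
  qed

  \<comment> \<open>Existence and uniqueness of the extension\<close>
  show ?thesis
  proof (intro ex1I[of _ F] conjI ballI)
    show "F \<in> weak_vector_valued \<F> smulE TE"
      using represent assms(11) by (auto simp: weak_vector_valued_def)
    show "F x = f x" if "x \<in> U" for x
    proof (rule G_eqI)
      fix e' assume "e' \<in> G"
      then have "e' \<in> topological_dual smulE TE" using assms(14) by blast
      from represent[OF this] that show "e' (F x) = e' (f x)" by auto
    qed
  next
    fix H assume H: "H \<in> weak_vector_valued \<F> smulE TE \<and> (\<forall>x\<in>U. H x = f x)"
    \<comment> \<open>For \<open>e'\<close> in \<open>G\<close>, both \<open>e' \<circ> H\<close>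
      and \<open>e' \<circ> F\<close> are elements of \<open>\<F>\<close> with the same values on
      \<open>U\<close>, so they coincide; \<open>G\<close> separates the points of E.\<close>
    show "H = F"
    proof (intro ext G_eqI)
      fix x e' assume "e' \<in> G"
      then have e': "e' \<in> topological_dual smulE TE" using assms(14) by blast
      then obtain h where h: "h \<in> \<F>" "\<And>x. x \<in> U \<Longrightarrow> h x = e' (f x)" "h = e' \<circ> F"
        using represent by blast
      have "e' \<circ> H \<in> \<F>" using H e' by (simp add: weak_vector_valued_def)
      then have "e' \<circ> H = h" using h(1,2) H by (intro F_eqI) auto
      with h(3) show "e' (H x) = e' (F x)" by (metis comp_apply)
    qed
  qed
qed

end
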